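(* For $\rho\in(0,\infty)$, the functions $f_\rho(1,u)$, $g_\rho(1,u)$, $a_\rho(1,u)$ and $b_\rho(1,u)$ satisfy, as $u\to\infty$, $$f_\rho(1,u)=u^{\zeta_f}e^{-2u}\,\Theta(1),\quad g_\rho(1,u)=u^{\zeta_g}e^{-2u}\,\Theta(1),\quad a_\rho(1,u)=u^{\zeta_a}e^{-2u}\,\Theta(1),\quad b_\rho(1,u)=u^{\zeta_b}e^{-2u}\,\Theta(1),$$ where $$\zeta_f=\frac{1+\rho}{2\rho^2},\qquad \zeta_g=\frac{1-\rho}{2\rho^2},\qquad \zeta_a=\frac{1+\rho}{2\rho^2}-1,\qquad \zeta_b=\frac{1-\rho}{2\rho^2}-1.$$ As $u\to-\infty$, the corresponding asymptotics are $$f_\rho(1,u)=|u|^{\zeta_g}e^{-2|u|}\,\Theta(1),\quad g_\rho(1,u)=|u|^{\zeta_f}e^{-2|u|}\,\Theta(1),\quad a_\rho(1,u)=|u|^{\zeta_b}e^{-2|u|}\,\Theta(1),\quad b_\rho(1,u)=|u|^{\zeta_a}e^{-2|u|}\,\Theta(1).$$ The $\Theta(1)$ factors are uniformly bounded away from zero and infinity for $\rho$ in any compact subset of $(0,\infty)$.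
   Context: For $\rho,\xi\in(0,\infty)$, $S_\rho(\xi,\bullet):\mathbb{R}\to(0,\infty)$ is the unique solution of $$\frac{d}{du}S_\rho(\xi,u)=-\frac{8\rho\,S_\rho(\xi,u)^{1+\rho}}{(1+S_\rho(\xi,u)^\rho)^2},\qquad S_\rho(\xi,0)=\xi.$$ Writing $S(r)=S_\rho(\xi,r)$, for $u\in\mathbb{R}$, $$f_\rho(\xi,u)=\exp\Big\{2\int_0^u\Big(1-\frac{2\big(1+(1-\rho)S(r)^\rho\big)}{(1+S(r)^\rho)^2}\Big)dr\Big\},$$ $$g_\rho(\xi,u)=\xi\cdot\exp\Big\{-2\int_0^u\Big(1-\frac{2\big((1-\rho)S(r)^\rho+S(r)^{2\rho}\big)}{(1+S(r)^\rho)^2}\Big)dr\Big\},$$ with the convention $\int_a^bh=-\int_b^ah$ for $a>b$. Further, with $f=f_\rho(\xi,u)$ and $g=g_\rho(\xi,u)$, $$a_\rho(\xi,u)=2\rho\,\frac{f^{1+\rho}g^\rho}{(f^\rho+g^\rho)^2},\qquad b_\rho(\xi,u)=2\rho\,\frac{f^{\rho}g^{1+\rho}}{(f^\rho+g^\rho)^2}.$$ $\Theta(1)$ denotes a quantity that is bounded away from zero and infinity for all sufficiently large $|u|$. *)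

theory Defs
  imports "HOL-Analysis.Analysis" "HOL-Library.Landau_Symbols"
begin

text \<open>For \<open>\<rho>, \<xi> > 0\<close> the description below has exactly one solution, defined on all of the real line;
  \<open>S_rho \<rho> \<xi>\<close> is that solution. For other parameters its value is unspecified and never used.\<close>

definition S_rho :: "real \<Rightarrow> real \<Rightarrow> real \<Rightarrow> real" where
  "S_rho \<rho> \<xi> = (THE s. s 0 = \<xi> \<and> (\<forall>u. s u > 0) \<and>
     (\<forall>u. (s has_real_derivative
            - (8 * \<rho> * s u powr (1 + \<rho>)) / (1 + s u powr \<rho>)\<^sup>2) (at u)))"

text \<open>The interval integral \<open>LBINT\<close> is signed: exchanging the end points changes the sign,
  so negative \<open>u\<close> are covered as well.\<close>

definition f_rho :: "real \<Rightarrow> real \<Rightarrow> real \<Rightarrow> real" where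
  "f_rho \<rho> \<xi> u = exp (2 * (LBINT r=ereal 0..ereal u.
     1 - 2 * (1 + (1 - \<rho>) * S_rho \<rho> \<xi> r powr \<rho>) / (1 + S_rho \<rho> \<xi> r powr \<rho>)\<^sup>2))"

definition g_rho :: "real \<Rightarrow> real \<Rightarrow> real \<Rightarrow> real" where
  "g_rho \<rho> \<xi> u = \<xi> * exp (- 2 * (LBINT r=ereal 0..ereal u.
     1 - 2 * ((1 - \<rho>) * S_rho \<rho> \<xi> r powr \<rho> + S_rho \<rho> \<xi> r powr (2 * \<rho>)) / (1 + S_rho \<rho> \<xi> r powr \<rho>)\<^sup>2))"

definition a_rho :: "real \<Rightarrow> real \<Rightarrow> real \<Rightarrow> real" where
  "a_rho \<rho> \<xi> u = 2 * \<rho> * (f_rho \<rho> \<xi> u powr (1 + \<rho>) * g_rho \<rho> \<xi> u powr \<rho>)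
     / (f_rho \<rho> \<xi> u powr \<rho> + g_rho \<rho> \<xi> u powr \<rho>)\<^sup>2"

definition b_rho :: "real \<Rightarrow> real \<Rightarrow> real \<Rightarrow> real" where
  "b_rho \<rho> \<xi> u = 2 * \<rho> * (f_rho \<rho> \<xi> u powr \<rho> * g_rho \<rho> \<xi> u powr (1 + \<rho>))
     / (f_rho \<rho> \<xi> u powr \<rho> + g_rho \<rho> \<xi> u powr \<rho>)\<^sup>2"

definition zeta_f :: "real \<Rightarrow> real" where "zeta_f \<rho> = (1 + \<rho>) / (2 * \<rho>\<^sup>2)"
definition zeta_g :: "real \<Rightarrow> real" where "zeta_g \<rho> = (1 - \<rho>) / (2 * \<rho>\<^sup>2)"
definition zeta_a :: "real \<Rightarrow> real" where "zeta_a \<rho> = (1 + \<rho>) / (2 * \<rho>\<^sup>2) - 1"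
definition zeta_b :: "real \<Rightarrow> real" where "zeta_b \<rho> = (1 - \<rho>) / (2 * \<rho>\<^sup>2) - 1"

text \<open>\<open>h \<rho> u = k \<rho> u \<cdot> \<Theta>(1)\<close> along the filter \<open>F\<close>, uniformly for \<open>\<rho> \<in> K\<close>: the bounds on the
  factor \<open>h / k\<close> and the range of \<open>u\<close> in which they hold do not depend on \<open>\<rho>\<close>.
  It is used only where \<open>k\<close> is nonzero eventually.\<close>

definition Theta_uniformly ::
    "real set \<Rightarrow> real filter \<Rightarrow> (real \<Rightarrow> real \<Rightarrow> real) \<Rightarrow> (real \<Rightarrow> real \<Rightarrow> real) \<Rightarrow> bool" where
  "Theta_uniformly K F h k \<longleftrightarrow>
     (\<exists>c>0. \<exists>C. \<forall>\<^sub>F u in F. \<forall>\<rho>\<in>K. c \<le> h \<rho> u / k \<rho> u \<and> h \<rho> u / k \<rho> u \<le> C)"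

end

theory Submission imports Defs begin

text \<open>The logarithm \<open>l\<close> of \<open>S\<^sup>\<rho>\<close> solves the autonomous equation
  \<open>l' = - 4 \<rho>\<^sup>2 / (1 + cosh l)\<close>, which integrates to \<open>sinh l + l = - 4 \<rho>\<^sup>2 u\<close>. In terms of \<open>l\<close> the
  integrals defining \<open>f\<close> and \<open>g\<close> are elementary, and the implicit equation gives
  \<open>f = exp (- 2 u - \<zeta>\<^sub>f l + O(1))\<close> and \<open>g = exp (- 2 u - \<zeta>\<^sub>g l + O(1))\<close> for \<open>u > 0\<close>, while
  \<open>g / f = S\<close> turns \<open>a\<close> and \<open>b\<close> into \<open>f\<close> and \<open>g\<close> times \<open>2 \<rho> e\<^sup>l / (1 + e\<^sup>l)\<^sup>2\<close>.
  The same equation shows that \<open>l + ln u\<close> is bounded for \<open>u \<ge> 1\<close>, with a bound continuous in \<open>\<rho>\<close>.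
  Since \<open>l\<close> is odd in \<open>u\<close>, the reflection \<open>u \<mapsto> - u\<close> exchanges \<open>f\<close> with \<open>g\<close> and \<open>a\<close> with \<open>b\<close>.\<close>

section \<open>The bijection sinh t + t and its inverse\<close>

lemma strict_mono_sinh_plus_id: "strict_mono (\<lambda>t::real. sinh t + t)"
  by (intro strict_monoI add_strict_mono) simp_all

lemma bij_sinh_plus_id: "bij (\<lambda>t::real. sinh t + t)"
proof (rule bijI)
  show "inj (\<lambda>t::real. sinh t + t)"
    using strict_mono_sinh_plus_id strict_mono_on_imp_inj_on by blast
  have "\<exists>t. sinh t + t = x" for x :: real
  proof -
    \<comment> \<open>Since sinh is odd and nonnegative at |x|, the values at -|x| and |x| lie at or
      beyond -|x| and |x|, so they enclose x.\<close>
    have "\<exists>t\<ge>- \<bar>x\<bar>. t \<le> \<bar>x\<bar> \<and> sinh t + t = x"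
    proof (rule IVT')
      have "sinh \<bar>x\<bar> \<ge> 0" "\<bar>x\<bar> \<ge> 0" by simp_all
      then show "sinh (- \<bar>x\<bar>) + - \<bar>x\<bar> \<le> x" "x \<le> sinh \<bar>x\<bar> + \<bar>x\<bar>"
        unfolding sinh_minus by linarith+
    qed (auto intro!: continuous_intros)
    then show ?thesis by blast
  qed
  then show "surj (\<lambda>t::real. sinh t + t)" unfolding surj_def by metis
qed

text \<open>Defining l by its implicit equation, not as \<open>\<rho> * ln\<close> of the solution,
  makes it available before the initial value problem is known to be solvable.\<close>

definition log_S_powr :: "real \<Rightarrow> real \<Rightarrow> real" where
  "log_S_powr \<rho> u = inv (\<lambda>t. sinh t + t) (- 4 * \<rho>\<^sup>2 * u)"

lemma log_S_powr_eq: "sinh (log_S_powr \<rho> u) + log_S_powr \<rho> u = - 4 * \<rho>\<^sup>2 * u"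
  unfolding log_S_powr_def
  using surj_f_inv_f[OF bij_is_surj[OF bij_sinh_plus_id]] by simp

lemma log_S_powr_unique:
  assumes "sinh t + t = - 4 * \<rho>\<^sup>2 * u" shows "log_S_powr \<rho> u = t"
  unfolding log_S_powr_def assms[symmetric]
  using inv_f_f[OF bij_is_inj[OF bij_sinh_plus_id]] by simp

lemma log_S_powr_0 [simp]: "log_S_powr \<rho> 0 = 0"
  by (rule log_S_powr_unique) simp

lemma log_S_powr_minus: "log_S_powr \<rho> (- u) = - log_S_powr \<rho> u"
  using log_S_powr_eq[of \<rho> u] by (intro log_S_powr_unique) simp

lemma log_S_powr_nonpos: "u \<ge> 0 \<Longrightarrow> log_S_powr \<rho> u \<le> 0"
proof (rule ccontr)
  assume "u \<ge> 0" and "\<not> log_S_powr \<rho> u \<le> 0"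
  then have "sinh (log_S_powr \<rho> u) + log_S_powr \<rho> u > 0" by (simp add: add_pos_pos)
  moreover have "4 * \<rho>\<^sup>2 * u \<ge> 0" using \<open>u \<ge> 0\<close> by simp
  ultimately show False using log_S_powr_eq[of \<rho> u] by linarith
qed

lemma one_plus_exp_nonzero [simp]: "1 + exp (t::real) \<noteq> 0"
  using exp_gt_zero[of t] by linarith

text \<open>Links the two shapes of the equation: inverting sinh t + t produces 1 + cosh, while the
  equation for S has the square of \<open>1 + exp l\<close> as denominator.\<close>

lemma one_plus_cosh_eq: "1 + cosh (t::real) = (1 + exp t)\<^sup>2 / (2 * exp t)"
  by (simp add: cosh_def exp_minus field_simps power2_eq_square)

text \<open>Inverse function rule: sinh t + t has the derivative cosh t + 1, which never vanishes;
  the inner factor \<open>- 4 * \<rho>\<^sup>2\<close> comes from the chain rule.\<close>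

lemma DERIV_log_S_powr:
  "(log_S_powr \<rho> has_real_derivative
     - (8 * \<rho>\<^sup>2 * exp (log_S_powr \<rho> u)) / (1 + exp (log_S_powr \<rho> u))\<^sup>2) (at u)"
proof -
  let ?F = "\<lambda>t::real. sinh t + t" and ?l = "log_S_powr \<rho> u"
  have gF: "inv ?F (?F t) = t" for t using inv_f_f[OF bij_is_inj[OF bij_sinh_plus_id]] .
  have Fg: "?F (inv ?F x) = x" for x using surj_f_inv_f[OF bij_is_surj[OF bij_sinh_plus_id]] .
  let ?x = "- 4 * \<rho>\<^sup>2 * u"
  \<comment> \<open>The inverse is two-sided on the whole line, so the radius 1 here and the
    interval of half-width 1 below are arbitrary choices.\<close>
  have "isCont (inv ?F) (?F (inv ?F ?x))"
    by (rule isCont_inverse_function[where d = 1 and f = ?F]) (simp_all add: gF isCont_sinh)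
  then have cont: "isCont (inv ?F) ?x" by (simp only: Fg)
  have l: "inv ?F ?x = ?l" by (simp add: log_S_powr_def)
  have nz: "cosh ?l + 1 \<noteq> 0" using cosh_real_pos[of ?l] by linarith
  have dF: "(?F has_real_derivative cosh ?l + 1) (at (inv ?F ?x))"
    unfolding l by (auto intro!: derivative_eq_intros)
  have "(inv ?F has_real_derivative inverse (cosh ?l + 1)) (at ?x)"
    by (rule DERIV_inverse_function[where f = ?F and a = "?x - 1" and b = "?x + 1"])
       (use dF nz cont Fg in auto)
  then have "((\<lambda>v. inv ?F (- 4 * \<rho>\<^sup>2 * v)) has_real_derivative
      inverse (cosh ?l + 1) * (- 4 * \<rho>\<^sup>2)) (at u)"
    by (rule DERIV_chain2) (auto intro!: derivative_eq_intros)
  moreover have "inverse (cosh ?l + 1) * (- 4 * \<rho>\<^sup>2) = - (8 * \<rho>\<^sup>2 * exp ?l) / (1 + exp ?l)\<^sup>2"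
    unfolding add.commute[of _ "1::real"] one_plus_cosh_eq by simp
  ultimately show ?thesis unfolding log_S_powr_def[abs_def] by simp
qed

lemma isCont_log_S_powr [continuous_intros]: "isCont (log_S_powr \<rho>) u"
  by (rule DERIV_isCont[OF DERIV_log_S_powr])

section \<open>The initial value problem for S\<close>

text \<open>Existence is the chain rule. Uniqueness comes from a first integral: every positive
  solution conserves sinh L + L + \<open>4 * \<rho>\<^sup>2 * u\<close>, and injectivity of sinh t +
  t then determines L.\<close>

lemma S_rho_eq:
  assumes "\<rho> > 0" shows "S_rho \<rho> 1 = (\<lambda>u. exp (log_S_powr \<rho> u / \<rho>))"
  unfolding S_rho_def
proof (rule the_equality)
  let ?s = "\<lambda>u. exp (log_S_powr \<rho> u / \<rho>)"
  have "(?s has_real_derivative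
      - (8 * \<rho> * ?s u powr (1 + \<rho>)) / (1 + ?s u powr \<rho>)\<^sup>2) (at u)" for u
  proof -
    have powr: "?s u powr \<rho> = exp (log_S_powr \<rho> u)"
      "?s u powr (1 + \<rho>) = ?s u * exp (log_S_powr \<rho> u)"
      using assms by (simp_all add: powr_add) (simp_all add: powr_def)
    show ?thesis
      unfolding powr using assms
      by (auto intro!: derivative_eq_intros DERIV_log_S_powr simp: power2_eq_square)
  qed
  then show "?s 0 = 1 \<and> (\<forall>u. ?s u > 0) \<and> (\<forall>u. (?s has_real_derivative
      - (8 * \<rho> * ?s u powr (1 + \<rho>)) / (1 + ?s u powr \<rho>)\<^sup>2) (at u))" by simp
next
  fix s assume s: "s 0 = 1 \<and> (\<forall>u. s u > 0) \<and> (\<forall>u. (s has_real_derivative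
      - (8 * \<rho> * s u powr (1 + \<rho>)) / (1 + s u powr \<rho>)\<^sup>2) (at u))"
  define L where "L = (\<lambda>u. \<rho> * ln (s u))"
  have powr: "s u powr \<rho> = exp (L u)" "s u powr (1 + \<rho>) = s u * exp (L u)" for u
  proof -
    have "s u > 0" using s by blast
    then show "s u powr \<rho> = exp (L u)" "s u powr (1 + \<rho>) = s u * exp (L u)"
      by (simp_all add: L_def powr_add) (simp_all add: powr_def)
  qed
  have dL: "(L has_real_derivative - (4 * \<rho>\<^sup>2) / (1 + cosh (L u))) (at u)" for u
  proof -
    have pos: "s u > 0"
      and ds: "(s has_real_derivative - (8 * \<rho> * (s u * exp (L u))) / (1 + exp (L u))\<^sup>2) (at u)"
      using s by (simp_all add: powr)
    have eq: "\<rho> * (- (8 * \<rho> * (s u * exp (L u))) / (1 + exp (L u))\<^sup>2 / s u) =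
        - (4 * \<rho>\<^sup>2) / (1 + cosh (L u))"
      unfolding one_plus_cosh_eq using pos by (simp add: power2_eq_square[of \<rho>])
    have "((\<lambda>u. \<rho> * ln (s u)) has_real_derivative
        \<rho> * (- (8 * \<rho> * (s u * exp (L u))) / (1 + exp (L u))\<^sup>2 / s u)) (at u)"
      using pos by (auto intro!: derivative_eq_intros ds)
    then show ?thesis unfolding eq L_def[symmetric] .
  qed
  \<comment> \<open>The derivative is (cosh L + 1) L' + \<open>4 * \<rho>\<^sup>2\<close>, which
    cancels by \<open>dL\<close>. The initial value \<open>s 0 = 1\<close> makes the constant
    zero.\<close>
  have "((\<lambda>u. sinh (L u) + L u + 4 * \<rho>\<^sup>2 * u) has_real_derivative 0) (at u)" for u
  proof -
    have "1 + cosh (L u) \<noteq> 0" using cosh_real_pos[of "L u"] by linarith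
    then show ?thesis
      by (auto intro!: derivative_eq_intros dL simp: field_simps)
  qed
  then have "sinh (L u) + L u + 4 * \<rho>\<^sup>2 * u = sinh (L 0) + L 0 + 4 * \<rho>\<^sup>2 * 0" for u
    using DERIV_isconst_all[of "\<lambda>u. sinh (L u) + L u + 4 * \<rho>\<^sup>2 * u"] by blast
  moreover have "L 0 = 0" using s by (simp add: L_def)
  ultimately have "log_S_powr \<rho> u = L u" for u
    by (intro log_S_powr_unique) (simp add: eq_neg_iff_add_eq_0)
  then show "s = (\<lambda>u. exp (log_S_powr \<rho> u / \<rho>))" using s assms by (auto simp: L_def)
qed

lemma S_rho_powr:
  "\<rho> > 0 \<Longrightarrow> S_rho \<rho> 1 u powr \<rho> = exp (log_S_powr \<rho> u)"
  "\<rho> > 0 \<Longrightarrow> S_rho \<rho> 1 u powr (2 * \<rho>) = (exp (log_S_powr \<rho> u))\<^sup>2"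
  by (simp_all add: S_rho_eq powr_def exp_double)

section \<open>Closed forms of f and g\<close>

text \<open>Covers both orders of the end points, so that the closed forms below hold for negative u
  as well.\<close>

lemma LBINT_eq_antiderivative:
  fixes F F' :: "real \<Rightarrow> real"
  assumes F: "\<And>x. (F has_real_derivative F' x) (at x)" and F': "\<And>x. isCont F' x"
  shows "(LBINT x=ereal a..ereal b. F' x) = F b - F a"
proof (rule interval_integral_FTC_finite)
  show "continuous_on {min a b..max a b} F'"
    using F' by (simp add: continuous_at_imp_continuous_on)
  show "(F has_vector_derivative F' x) (at x within {min a b..max a b})" for x
    using has_field_derivative_at_within[OF F]
    by (simp add: has_real_derivative_iff_has_vector_derivative)
qed

text \<open>The implicit equation with sinh written in exponentials. It trades
  \<open>exp (- l)\<close>, which is unbounded as u grows, for terms linear in u and l plus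
  \<open>exp l\<close>, which stays at most 1 for u \<ge> 0.\<close>

lemma exp_minus_log_S_powr:
  "exp (- log_S_powr \<rho> u) = exp (log_S_powr \<rho> u) + 2 * log_S_powr \<rho> u + 8 * \<rho>\<^sup>2 * u"
  using log_S_powr_eq[of \<rho> u] by (simp add: sinh_def field_simps)

lemma f_rho_eq:
  assumes "\<rho> > 0"
  shows "f_rho \<rho> 1 u =
    exp (- 2 * u - zeta_f \<rho> * log_S_powr \<rho> u + (1 - exp (log_S_powr \<rho> u)) / (2 * \<rho>\<^sup>2))"
proof -
  let ?l = "log_S_powr \<rho>"
  \<comment> \<open>With y = \<open>exp l\<close>, the equation for l reads 2 y / (1 + y)^2 = - l' /
    (4 \<rho>^2). The fraction in the integrand is therefore - (1 / y + 1 - \<rho>) l' / (4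
    \<rho>^2), which integrates at once; the constant 1 makes ?F vanish at 0.\<close>
  let ?F = "\<lambda>u. u + (1 - exp (- ?l u) + (1 - \<rho>) * ?l u) / (4 * \<rho>\<^sup>2)"
  let ?F' = "\<lambda>u. 1 - 2 * (1 + (1 - \<rho>) * exp (?l u)) / (1 + exp (?l u))\<^sup>2"
  have "(LBINT r=ereal 0..ereal u. ?F' r) = ?F u - ?F 0"
  proof (rule LBINT_eq_antiderivative)
    \<comment> \<open>Here \<open>y\<close> stands for \<open>exp l\<close> and \<open>q\<close> for
      the square of \<open>1 + exp l\<close>, which never has to be expanded.\<close>
    have algebra: "1 + (inverse y * (- (8 * \<rho>\<^sup>2 * y) / q) + (1 - \<rho>) * (- (8 * \<rho>\<^sup>2 * y) / q)) / (4 * \<rho>\<^sup>2) =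
        1 - 2 * (1 + (1 - \<rho>) * y) / q" if "y > 0" "q \<noteq> 0" for y q :: real
      using that assms by (simp add: field_simps power2_eq_square)
    show "(?F has_real_derivative ?F' u) (at u)" for u
    proof -
      have "(?l has_real_derivative D) (at u) \<Longrightarrow>
          ((\<lambda>u. 1 - exp (- ?l u) + (1 - \<rho>) * ?l u) has_real_derivative exp (- ?l u) * D + (1 - \<rho>) * D) (at u)" for D
        by (auto intro!: derivative_eq_intros simp: algebra_simps)
      note DERIV_add[OF DERIV_ident DERIV_cdivide[OF this[OF DERIV_log_S_powr], of "4 * \<rho>\<^sup>2"]]
      then show ?thesis
        by (rule DERIV_cong) (simp only: exp_minus, rule algebra, simp_all)
    qed
    show "isCont ?F' u" for u by (intro continuous_intros) auto
  qed
  \<comment> \<open>Substituting for \<open>exp (- l)\<close> contributes - 4 u, which reverses the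
    sign of 2 u, and turns the coefficient 1 - \<rho> of l into - (1 + \<rho>), the numerator of -
    \<open>zeta_f\<close>.\<close>
  moreover have "2 * ?F u = - 2 * u - zeta_f \<rho> * ?l u + (1 - exp (?l u)) / (2 * \<rho>\<^sup>2)"
    using assms by (simp add: exp_minus_log_S_powr zeta_f_def field_simps)
  ultimately show ?thesis using assms by (simp add: f_rho_def S_rho_powr)
qed

lemma g_rho_eq:
  assumes "\<rho> > 0"
  shows "g_rho \<rho> 1 u =
    exp (- 2 * u - zeta_g \<rho> * log_S_powr \<rho> u + (1 - exp (log_S_powr \<rho> u)) / (2 * \<rho>\<^sup>2))"
proof -
  let ?l = "log_S_powr \<rho>"
  \<comment> \<open>The same substitution as for f, with the integrand carrying one more factor y:
    the antiderivative contains \<open>exp l\<close> in place of \<open>exp (- l)\<close> and has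
    its final form without the implicit equation.\<close>
  let ?F = "\<lambda>u. u + ((1 - \<rho>) * ?l u + exp (?l u) - 1) / (4 * \<rho>\<^sup>2)"
  let ?F' = "\<lambda>u. 1 - 2 * ((1 - \<rho>) * exp (?l u) + (exp (?l u))\<^sup>2) / (1 + exp (?l u))\<^sup>2"
  have "(LBINT r=ereal 0..ereal u. ?F' r) = ?F u - ?F 0"
  proof (rule LBINT_eq_antiderivative)
    have algebra: "1 + (y * (- (8 * \<rho>\<^sup>2 * y) / q) + (1 - \<rho>) * (- (8 * \<rho>\<^sup>2 * y) / q)) / (4 * \<rho>\<^sup>2) =
        1 - 2 * ((1 - \<rho>) * y + y\<^sup>2) / q" if "y > 0" "q \<noteq> 0" for y q :: real
      using that assms by (simp add: field_simps power2_eq_square)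
    show "(?F has_real_derivative ?F' u) (at u)" for u
    proof -
      have "(?l has_real_derivative D) (at u) \<Longrightarrow>
          ((\<lambda>u. (1 - \<rho>) * ?l u + exp (?l u) - 1) has_real_derivative exp (?l u) * D + (1 - \<rho>) * D) (at u)" for D
        by (auto intro!: derivative_eq_intros simp: algebra_simps)
      note DERIV_add[OF DERIV_ident DERIV_cdivide[OF this[OF DERIV_log_S_powr], of "4 * \<rho>\<^sup>2"]]
      then show ?thesis
        by (rule DERIV_cong) (rule algebra, simp_all)
    qed
    show "isCont ?F' u" for u by (intro continuous_intros) auto
  qed
  moreover have "- 2 * ?F u = - 2 * u - zeta_g \<rho> * ?l u + (1 - exp (?l u)) / (2 * \<rho>\<^sup>2)"
    using assms by (simp add: zeta_g_def field_simps)
  ultimately show ?thesis using assms by (simp add: g_rho_def S_rho_powr)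
qed

text \<open>The two closed forms differ only in the coefficient of l, and \<open>zeta_f\<close>
  exceeds \<open>zeta_g\<close> by 1 / \<rho>.\<close>

lemma g_rho_eq_f_rho:
  assumes "\<rho> > 0" shows "g_rho \<rho> 1 u = exp (log_S_powr \<rho> u / \<rho>) * f_rho \<rho> 1 u"
proof -
  have zeta: "zeta_g \<rho> = zeta_f \<rho> - 1 / \<rho>"
    using assms by (simp add: zeta_f_def zeta_g_def field_simps power2_eq_square)
  show ?thesis
    unfolding f_rho_eq[OF assms] g_rho_eq[OF assms] exp_add[symmetric] zeta
    by (simp add: algebra_simps)
qed

section \<open>The weight in a and b, and reflection of u\<close>

text \<open>Since (g / f)^\<rho> = \<open>exp l\<close>, the square of f^\<rho> factors out of
  numerator and denominator and cancels.\<close>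

lemma a_rho_b_rho_eq:
  assumes "\<rho> > 0"
  defines "w \<equiv> \<lambda>u. 2 * \<rho> * exp (log_S_powr \<rho> u) / (1 + exp (log_S_powr \<rho> u))\<^sup>2"
  shows "a_rho \<rho> 1 u = w u * f_rho \<rho> 1 u" and "b_rho \<rho> 1 u = w u * g_rho \<rho> 1 u"
proof -
  define f where "f = f_rho \<rho> 1 u"
  define y where "y = exp (log_S_powr \<rho> u)"
  define s where "s = exp (log_S_powr \<rho> u / \<rho>)"
  have pos: "f > 0" "f powr \<rho> > 0" "y > 0" "s > 0"
    by (simp_all add: f_def f_rho_def y_def s_def)
  have g: "g_rho \<rho> 1 u = s * f"
    by (simp add: s_def f_def g_rho_eq_f_rho[OF assms(1)])
  have "s powr \<rho> = y" using assms by (simp add: s_def y_def powr_def)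
  then have powrs: "(s * f) powr \<rho> = y * f powr \<rho>" "(s * f) powr (1 + \<rho>) = s * f * (y * f powr \<rho>)"
    "f powr (1 + \<rho>) = f * f powr \<rho>"
    using pos by (simp_all add: powr_mult powr_add)
  have sq: "(f powr \<rho> + y * f powr \<rho>)\<^sup>2 = (1 + y)\<^sup>2 * (f powr \<rho>)\<^sup>2"
    by (simp add: power2_eq_square algebra_simps)
  have "1 + y > 0" using pos by simp
  then show "a_rho \<rho> 1 u = w u * f_rho \<rho> 1 u" "b_rho \<rho> 1 u = w u * g_rho \<rho> 1 u"
    using pos
    unfolding a_rho_def b_rho_def w_def g f_def[symmetric] y_def[symmetric] powrs sq
    by (simp_all add: power2_eq_square[of "f powr \<rho>"])
qed

text \<open>Oddness of l brings \<open>exp (- l)\<close> into the closed form of f; eliminating it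
  by the implicit equation changes the coefficient \<open>zeta_f\<close> of l into
  \<open>zeta_f\<close> - 1 / \<rho>^2 = - \<open>zeta_g\<close>.\<close>

lemma f_rho_minus:
  assumes "\<rho> > 0" shows "f_rho \<rho> 1 (- u) = g_rho \<rho> 1 u"
  using assms
  by (simp add: f_rho_eq g_rho_eq log_S_powr_minus exp_minus_log_S_powr
      zeta_f_def zeta_g_def field_simps)

lemma g_rho_minus: "\<rho> > 0 \<Longrightarrow> g_rho \<rho> 1 (- u) = f_rho \<rho> 1 u"
  using f_rho_minus[of \<rho> "- u"] by simp

lemma a_rho_minus: "\<rho> > 0 \<Longrightarrow> a_rho \<rho> 1 (- u) = b_rho \<rho> 1 u"
  by (simp add: a_rho_def b_rho_def f_rho_minus g_rho_minus add.commute mult.commute)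

lemma b_rho_minus: "\<rho> > 0 \<Longrightarrow> b_rho \<rho> 1 (- u) = a_rho \<rho> 1 u"
  using a_rho_minus[of \<rho> "- u"] by simp

section \<open>Logarithmic growth of l and uniform bounds\<close>

text \<open>With z = \<open>exp (- l)\<close>, the quotient z / u lies between the arguments of the
  two logarithms. Adding their absolute values gives one bound for both signs, continuous in \<rho>
  > 0.\<close>

lemma log_S_powr_plus_ln_bound:
  assumes "\<rho> > 0" "u \<ge> 1"
  shows "\<bar>log_S_powr \<rho> u + ln u\<bar> \<le> \<bar>ln (8 * \<rho>\<^sup>2 / 3)\<bar> + \<bar>ln (8 * \<rho>\<^sup>2 + 1)\<bar>"
proof -
  define z where "z = exp (- log_S_powr \<rho> u)"
  have l: "log_S_powr \<rho> u = - ln z" by (simp add: z_def)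
  have "log_S_powr \<rho> u \<le> 0" using assms by (simp add: log_S_powr_nonpos)
  then have z: "z \<ge> 1" by (simp add: z_def)
  have eq: "z - 1 / z + 2 * ln z = 8 * \<rho>\<^sup>2 * u"
    using log_S_powr_eq[of \<rho> u] z by (simp add: l sinh_def exp_minus field_simps)
  have "1 / z > 0" "1 / z \<le> 1" "ln z \<ge> 0" using z by simp_all
  \<comment> \<open>The 3 below arises as z + 2 ln z \<le> z + 2 (z - 1) \<le> 3 z.\<close>
  have "ln z \<le> z - 1" using z by (intro ln_le_minus_one) simp
  with eq \<open>1 / z > 0\<close> have "8 * \<rho>\<^sup>2 * u \<le> 3 * z" by linarith
  then have lo: "8 * \<rho>\<^sup>2 / 3 * u \<le> z" by simp
  \<comment> \<open>Here u \<ge> 1 absorbs the term 1 / z \<le> 1.\<close>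
  have "z \<le> 8 * \<rho>\<^sup>2 * u + u" using eq \<open>1 / z \<le> 1\<close> \<open>ln z \<ge> 0\<close> assms by linarith
  then have hi: "z \<le> (8 * \<rho>\<^sup>2 + 1) * u" by (simp add: algebra_simps)
  have p: "8 * \<rho>\<^sup>2 / 3 > 0" "8 * \<rho>\<^sup>2 + 1 > 0" "u > 0" "z > 0"
    using assms z by (simp_all add: add_pos_pos)
  have "ln (8 * \<rho>\<^sup>2 / 3 * u) \<le> ln z" using lo p by (subst ln_le_cancel_iff) (auto intro: mult_pos_pos)
  then have 1: "ln (8 * \<rho>\<^sup>2 / 3) + ln u \<le> ln z" using p by (subst (asm) ln_mult_pos) auto
  have "ln z \<le> ln ((8 * \<rho>\<^sup>2 + 1) * u)" using hi p by (subst ln_le_cancel_iff) (auto intro: mult_pos_pos)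
  then have 2: "ln z \<le> ln (8 * \<rho>\<^sup>2 + 1) + ln u" using p by (subst (asm) ln_mult_pos) auto
  show ?thesis using 1 2 unfolding l by linarith
qed

text \<open>Writing the power of u as an exponential, the quotient becomes exp of d - \<zeta> (l +
  ln u). This exponent is dominated by a continuous function of \<rho>, which is bounded on the
  compact set K.\<close>

lemma Theta_uniformly_at_topI:
  assumes "compact K" "K \<subseteq> {0<..}" "continuous_on K \<zeta>" "continuous_on K \<delta>"
    and h: "\<And>\<rho> u. \<rho> \<in> K \<Longrightarrow> u \<ge> 1 \<Longrightarrow> h \<rho> u = exp (- 2 * u - \<zeta> \<rho> * log_S_powr \<rho> u + d \<rho> u)"
    and d: "\<And>\<rho> u. \<rho> \<in> K \<Longrightarrow> u \<ge> 1 \<Longrightarrow> \<bar>d \<rho> u\<bar> \<le> \<delta> \<rho>"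
  shows "Theta_uniformly K at_top h (\<lambda>\<rho> u. u powr \<zeta> \<rho> * exp (- 2 * u))"
proof -
  define \<beta> where "\<beta> = (\<lambda>\<rho>. \<bar>\<zeta> \<rho>\<bar> * (\<bar>ln (8 * \<rho>\<^sup>2 / 3)\<bar> + \<bar>ln (8 * \<rho>\<^sup>2 + 1)\<bar>) + \<delta> \<rho>)"
  have nz: "8 * \<rho>\<^sup>2 + 1 \<noteq> 0" for \<rho> :: real
    using zero_le_power2[of \<rho>] by linarith
  have "continuous_on K \<beta>"
    unfolding \<beta>_def using assms(2) nz
    by (intro continuous_intros assms(3,4)) auto
  then have "bounded (\<beta> ` K)"
    using assms(1) compact_continuous_image compact_imp_bounded by blast
  then obtain B where B: "\<And>\<rho>. \<rho> \<in> K \<Longrightarrow> \<bar>\<beta> \<rho>\<bar> \<le> B" by (auto simp: bounded_iff)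
  have "exp (- B) \<le> h \<rho> u / (u powr \<zeta> \<rho> * exp (- 2 * u)) \<and>
      h \<rho> u / (u powr \<zeta> \<rho> * exp (- 2 * u)) \<le> exp B" if "u \<ge> 1" "\<rho> \<in> K" for u \<rho>
  proof -
    define e where "e = d \<rho> u - \<zeta> \<rho> * (log_S_powr \<rho> u + ln u)"
    have "\<rho> > 0" using that assms(2) by auto
    have "\<bar>e\<bar> \<le> \<bar>\<zeta> \<rho> * (log_S_powr \<rho> u + ln u)\<bar> + \<bar>d \<rho> u\<bar>" by (simp add: e_def)
    also have "\<dots> \<le> \<beta> \<rho>"
      unfolding \<beta>_def abs_mult
      using \<open>\<rho> > 0\<close> that by (intro add_mono mult_left_mono log_S_powr_plus_ln_bound d) auto
    also have "\<dots> \<le> B" using B[OF that(2)] by linarith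
    finally have "- B \<le> e" "e \<le> B" by linarith+
    moreover have "h \<rho> u / (u powr \<zeta> \<rho> * exp (- 2 * u)) = exp e"
    proof -
      have "u powr \<zeta> \<rho> * exp (- 2 * u) = exp (\<zeta> \<rho> * ln u + - 2 * u)"
        using that unfolding exp_add by (simp add: powr_def)
      then show ?thesis
        unfolding h[OF that(2,1)] by (simp only: exp_diff[symmetric]) (simp add: e_def algebra_simps)
    qed
    ultimately show ?thesis by simp
  qed
  then have "\<forall>\<^sub>F u in at_top. \<forall>\<rho>\<in>K. exp (- B) \<le> h \<rho> u / (u powr \<zeta> \<rho> * exp (- 2 * u)) \<and>
      h \<rho> u / (u powr \<zeta> \<rho> * exp (- 2 * u)) \<le> exp B"
    by (auto intro!: eventually_at_top_linorderI[of 1])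
  then show ?thesis unfolding Theta_uniformly_def by (meson exp_gt_zero)
qed

text \<open>\<open>at_bot\<close> is the image of \<open>at_top\<close> under negation. Comparison
  functions are matched only for u > 0, where |- u| = u.\<close>

lemma Theta_uniformly_mirror:
  assumes "Theta_uniformly K at_top h k"
    and h: "\<And>\<rho> u. \<rho> \<in> K \<Longrightarrow> h' \<rho> (- u) = h \<rho> u"
    and k: "\<And>\<rho> u. u > 0 \<Longrightarrow> k' \<rho> (- u) = k \<rho> u"
  shows "Theta_uniformly K at_bot h' k'"
proof -
  obtain c C where c: "c > 0"
    and ev: "\<forall>\<^sub>F u in at_top. \<forall>\<rho>\<in>K. c \<le> h \<rho> u / k \<rho> u \<and> h \<rho> u / k \<rho> u \<le> C"
    using assms(1) unfolding Theta_uniformly_def by blast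
  have "\<forall>\<^sub>F u in at_top. \<forall>\<rho>\<in>K. c \<le> h' \<rho> (- u) / k' \<rho> (- u) \<and> h' \<rho> (- u) / k' \<rho> (- u) \<le> C"
    using ev eventually_gt_at_top[of 0] by eventually_elim (simp add: h k)
  then show ?thesis
    using c unfolding Theta_uniformly_def at_bot_mirror eventually_filtermap by blast
qed

text \<open>Where \<open>k\<close> vanishes, \<open>h / k = 0\<close> contradicts the lower bound.\<close>

lemma Theta_uniformly_imp_bigtheta:
  assumes "Theta_uniformly {\<rho>} F h k" shows "h \<rho> \<in> \<Theta>[F](k \<rho>)"
proof -
  obtain c C where c: "c > 0"
    and ev: "\<forall>\<^sub>F u in F. c \<le> h \<rho> u / k \<rho> u \<and> h \<rho> u / k \<rho> u \<le> C"
    using assms unfolding Theta_uniformly_def by auto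
  have "\<forall>\<^sub>F u in F. c * \<bar>k \<rho> u\<bar> \<le> \<bar>h \<rho> u\<bar> \<and> \<bar>h \<rho> u\<bar> \<le> C * \<bar>k \<rho> u\<bar>"
    using ev
  proof eventually_elim
    case (elim u)
    then have "k \<rho> u \<noteq> 0" using c by auto
    moreover have "\<bar>h \<rho> u\<bar> / \<bar>k \<rho> u\<bar> = h \<rho> u / k \<rho> u"
      using elim c by (metis abs_divide abs_of_pos less_le_trans)
    ultimately show ?case using elim
      by (metis pos_le_divide_eq pos_divide_le_eq zero_less_abs_iff)
  qed
  then have "\<forall>\<^sub>F u in F. norm (h \<rho> u) \<le> C * norm (k \<rho> u)" "\<forall>\<^sub>F u in F. c * norm (k \<rho> u) \<le> norm (h \<rho> u)"
    by (auto elim: eventually_mono)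
  then have "h \<rho> \<in> O[F](k \<rho>)" "h \<rho> \<in> \<Omega>[F](k \<rho>)"
    by (simp_all add: bigoI landau_omega.bigI[OF c])
  then show ?thesis by (rule bigthetaI)
qed

section \<open>Asymptotics of f, g, a and b\<close>

lemma Theta_uniformly_rho:
  assumes K: "compact K" "K \<subseteq> {0<..}"
  shows "Theta_uniformly K at_top (\<lambda>\<rho> u. f_rho \<rho> 1 u) (\<lambda>\<rho> u. u powr zeta_f \<rho> * exp (- 2 * u))"
    and "Theta_uniformly K at_top (\<lambda>\<rho> u. g_rho \<rho> 1 u) (\<lambda>\<rho> u. u powr zeta_g \<rho> * exp (- 2 * u))"
    and "Theta_uniformly K at_top (\<lambda>\<rho> u. a_rho \<rho> 1 u) (\<lambda>\<rho> u. u powr zeta_a \<rho> * exp (- 2 * u))"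
    and "Theta_uniformly K at_top (\<lambda>\<rho> u. b_rho \<rho> 1 u) (\<lambda>\<rho> u. u powr zeta_b \<rho> * exp (- 2 * u))"
proof -
  have pos: "\<rho> > 0" if "\<rho> \<in> K" for \<rho> using that K by auto
  define d where "d = (\<lambda>\<rho> u. (1 - exp (log_S_powr \<rho> u)) / (2 * \<rho>\<^sup>2))"
  \<comment> \<open>\<open>w\<close> is the logarithm of the weight of a and b after removal of the
    unbounded part l; it is bounded because 0 \<le> ln (1 + \<open>exp l\<close>) \<le> ln 2 when l
    \<le> 0.\<close>
  define w where "w = (\<lambda>\<rho> u. ln (2 * \<rho>) - 2 * ln (1 + exp (log_S_powr \<rho> u)))"
  have d: "\<bar>d \<rho> u\<bar> \<le> 1 / (2 * \<rho>\<^sup>2)" if "\<rho> \<in> K" "u \<ge> 1" for \<rho> u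
    using that log_S_powr_nonpos[of u \<rho>]
    by (auto simp: d_def abs_divide intro!: divide_right_mono)
  have w: "\<bar>w \<rho> u\<bar> \<le> \<bar>ln (2 * \<rho>)\<bar> + 2 * ln 2" if "\<rho> \<in> K" "u \<ge> 1" for \<rho> u
  proof -
    have "exp (log_S_powr \<rho> u) \<le> 1" using that log_S_powr_nonpos[of u \<rho>] by simp
    then have "1 + exp (log_S_powr \<rho> u) \<le> 2" by simp
    moreover have "1 + exp (log_S_powr \<rho> u) > 0" by (simp add: add_pos_pos)
    ultimately have "ln (1 + exp (log_S_powr \<rho> u)) \<le> ln 2" by simp
    moreover have "ln (1 + exp (log_S_powr \<rho> u)) \<ge> 0" by simp
    ultimately show ?thesis unfolding w_def by linarith
  qed
  have dw: "\<bar>d \<rho> u + w \<rho> u\<bar> \<le> 1 / (2 * \<rho>\<^sup>2) + (\<bar>ln (2 * \<rho>)\<bar> + 2 * ln 2)" if "\<rho> \<in> K" "u \<ge> 1" for \<rho> u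
    using d[OF that] w[OF that] by linarith
  have weight: "2 * \<rho> * exp (log_S_powr \<rho> u) / (1 + exp (log_S_powr \<rho> u))\<^sup>2 =
      exp (log_S_powr \<rho> u + w \<rho> u)" if "\<rho> \<in> K" for \<rho> u
  proof -
    have "1 + exp (log_S_powr \<rho> u) > 0" by (simp add: add_pos_pos)
    then show ?thesis
      using pos[OF that] by (simp add: w_def exp_add exp_diff exp_double)
  qed
  have cont: "continuous_on K (\<lambda>\<rho>. 1 / (2 * \<rho>\<^sup>2))"
    "continuous_on K (\<lambda>\<rho>. 1 / (2 * \<rho>\<^sup>2) + (\<bar>ln (2 * \<rho>)\<bar> + 2 * ln 2))"
    "continuous_on K zeta_f" "continuous_on K zeta_g" "continuous_on K zeta_a" "continuous_on K zeta_b"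
    unfolding zeta_f_def[abs_def] zeta_g_def[abs_def] zeta_a_def[abs_def] zeta_b_def[abs_def]
    using pos by (auto intro!: continuous_intros dest: pos)
  have f: "f_rho \<rho> 1 u = exp (- 2 * u - zeta_f \<rho> * log_S_powr \<rho> u + d \<rho> u)"
    and g: "g_rho \<rho> 1 u = exp (- 2 * u - zeta_g \<rho> * log_S_powr \<rho> u + d \<rho> u)"
    if "\<rho> \<in> K" for \<rho> u
    using pos[OF that] by (simp_all add: d_def f_rho_eq g_rho_eq)
  have a: "a_rho \<rho> 1 u = exp (- 2 * u - zeta_a \<rho> * log_S_powr \<rho> u + (d \<rho> u + w \<rho> u))"
    and b: "b_rho \<rho> 1 u = exp (- 2 * u - zeta_b \<rho> * log_S_powr \<rho> u + (d \<rho> u + w \<rho> u))"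
    if "\<rho> \<in> K" for \<rho> u
  proof -
    \<comment> \<open>The factor \<open>exp l\<close> of the weight, of order 1 / u, accounts for
      the drop of the exponent by one.\<close>
    have zeta: "zeta_a \<rho> = zeta_f \<rho> - 1" "zeta_b \<rho> = zeta_g \<rho> - 1"
      by (simp_all add: zeta_a_def zeta_b_def zeta_f_def zeta_g_def)
    show "a_rho \<rho> 1 u = exp (- 2 * u - zeta_a \<rho> * log_S_powr \<rho> u + (d \<rho> u + w \<rho> u))"
      "b_rho \<rho> 1 u = exp (- 2 * u - zeta_b \<rho> * log_S_powr \<rho> u + (d \<rho> u + w \<rho> u))"
      unfolding a_rho_b_rho_eq[OF pos[OF that]] weight[OF that] f[OF that] g[OF that]
        exp_add[symmetric] zeta by (simp_all add: algebra_simps)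
  qed
  show "Theta_uniformly K at_top (\<lambda>\<rho> u. f_rho \<rho> 1 u) (\<lambda>\<rho> u. u powr zeta_f \<rho> * exp (- 2 * u))"
    by (rule Theta_uniformly_at_topI[OF K cont(3,1) f d])
  show "Theta_uniformly K at_top (\<lambda>\<rho> u. g_rho \<rho> 1 u) (\<lambda>\<rho> u. u powr zeta_g \<rho> * exp (- 2 * u))"
    by (rule Theta_uniformly_at_topI[OF K cont(4,1) g d])
  show "Theta_uniformly K at_top (\<lambda>\<rho> u. a_rho \<rho> 1 u) (\<lambda>\<rho> u. u powr zeta_a \<rho> * exp (- 2 * u))"
    by (rule Theta_uniformly_at_topI[OF K cont(5,2) a dw])
  show "Theta_uniformly K at_top (\<lambda>\<rho> u. b_rho \<rho> 1 u) (\<lambda>\<rho> u. u powr zeta_b \<rho> * exp (- 2 * u))"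
    by (rule Theta_uniformly_at_topI[OF K cont(6,2) b dw])
qed

lemma Theta_uniformly_rho_at_bot:
  assumes K: "compact K" "K \<subseteq> {0<..}"
  shows "Theta_uniformly K at_bot (\<lambda>\<rho> u. f_rho \<rho> 1 u) (\<lambda>\<rho> u. \<bar>u\<bar> powr zeta_g \<rho> * exp (- 2 * \<bar>u\<bar>))"
    and "Theta_uniformly K at_bot (\<lambda>\<rho> u. g_rho \<rho> 1 u) (\<lambda>\<rho> u. \<bar>u\<bar> powr zeta_f \<rho> * exp (- 2 * \<bar>u\<bar>))"
    and "Theta_uniformly K at_bot (\<lambda>\<rho> u. a_rho \<rho> 1 u) (\<lambda>\<rho> u. \<bar>u\<bar> powr zeta_b \<rho> * exp (- 2 * \<bar>u\<bar>))"
    and "Theta_uniformly K at_bot (\<lambda>\<rho> u. b_rho \<rho> 1 u) (\<lambda>\<rho> u. \<bar>u\<bar> powr zeta_a \<rho> * exp (- 2 * \<bar>u\<bar>))"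
proof -
  have pos: "\<rho> > 0" if "\<rho> \<in> K" for \<rho> using that K by auto
  \<comment> \<open>Each claim at minus infinity uses the partner function at plus infinity, hence
    the crossed indices below.\<close>
  note mirror = Theta_uniformly_rho[OF K, THEN Theta_uniformly_mirror]
  show "Theta_uniformly K at_bot (\<lambda>\<rho> u. f_rho \<rho> 1 u) (\<lambda>\<rho> u. \<bar>u\<bar> powr zeta_g \<rho> * exp (- 2 * \<bar>u\<bar>))"
    by (rule mirror(2)) (simp_all add: pos f_rho_minus)
  show "Theta_uniformly K at_bot (\<lambda>\<rho> u. g_rho \<rho> 1 u) (\<lambda>\<rho> u. \<bar>u\<bar> powr zeta_f \<rho> * exp (- 2 * \<bar>u\<bar>))"
    by (rule mirror(1)) (simp_all add: pos g_rho_minus)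
  show "Theta_uniformly K at_bot (\<lambda>\<rho> u. a_rho \<rho> 1 u) (\<lambda>\<rho> u. \<bar>u\<bar> powr zeta_b \<rho> * exp (- 2 * \<bar>u\<bar>))"
    by (rule mirror(4)) (simp_all add: pos a_rho_minus)
  show "Theta_uniformly K at_bot (\<lambda>\<rho> u. b_rho \<rho> 1 u) (\<lambda>\<rho> u. \<bar>u\<bar> powr zeta_a \<rho> * exp (- 2 * \<bar>u\<bar>))"
    by (rule mirror(3)) (simp_all add: pos b_rho_minus)
qed

theorem proposition1p19:
  "(\<forall>\<rho>::real. \<rho> > 0 \<longrightarrow>
        f_rho \<rho> 1 \<in> \<Theta>[at_top](\<lambda>u. u powr zeta_f \<rho> * exp (- 2 * u)) \<and>
        g_rho \<rho> 1 \<in> \<Theta>[at_top](\<lambda>u. u powr zeta_g \<rho> * exp (- 2 * u)) \<and>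
        a_rho \<rho> 1 \<in> \<Theta>[at_top](\<lambda>u. u powr zeta_a \<rho> * exp (- 2 * u)) \<and>
        b_rho \<rho> 1 \<in> \<Theta>[at_top](\<lambda>u. u powr zeta_b \<rho> * exp (- 2 * u)) \<and>
        f_rho \<rho> 1 \<in> \<Theta>[at_bot](\<lambda>u. \<bar>u\<bar> powr zeta_g \<rho> * exp (- 2 * \<bar>u\<bar>)) \<and>
        g_rho \<rho> 1 \<in> \<Theta>[at_bot](\<lambda>u. \<bar>u\<bar> powr zeta_f \<rho> * exp (- 2 * \<bar>u\<bar>)) \<and>
        a_rho \<rho> 1 \<in> \<Theta>[at_bot](\<lambda>u. \<bar>u\<bar> powr zeta_b \<rho> * exp (- 2 * \<bar>u\<bar>)) \<and>
        b_rho \<rho> 1 \<in> \<Theta>[at_bot](\<lambda>u. \<bar>u\<bar> powr zeta_a \<rho> * exp (- 2 * \<bar>u\<bar>))) \<and>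
    (\<forall>K::real set. compact K \<longrightarrow> K \<subseteq> {0<..} \<longrightarrow>
        Theta_uniformly K at_top (\<lambda>\<rho> u. f_rho \<rho> 1 u) (\<lambda>\<rho> u. u powr zeta_f \<rho> * exp (- 2 * u)) \<and>
        Theta_uniformly K at_top (\<lambda>\<rho> u. g_rho \<rho> 1 u) (\<lambda>\<rho> u. u powr zeta_g \<rho> * exp (- 2 * u)) \<and>
        Theta_uniformly K at_top (\<lambda>\<rho> u. a_rho \<rho> 1 u) (\<lambda>\<rho> u. u powr zeta_a \<rho> * exp (- 2 * u)) \<and>
        Theta_uniformly K at_top (\<lambda>\<rho> u. b_rho \<rho> 1 u) (\<lambda>\<rho> u. u powr zeta_b \<rho> * exp (- 2 * u)) \<and>
        Theta_uniformly K at_bot (\<lambda>\<rho> u. f_rho \<rho> 1 u) (\<lambda>\<rho> u. \<bar>u\<bar> powr zeta_g \<rho> * exp (- 2 * \<bar>u\<bar>)) \<and>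
        Theta_uniformly K at_bot (\<lambda>\<rho> u. g_rho \<rho> 1 u) (\<lambda>\<rho> u. \<bar>u\<bar> powr zeta_f \<rho> * exp (- 2 * \<bar>u\<bar>)) \<and>
        Theta_uniformly K at_bot (\<lambda>\<rho> u. a_rho \<rho> 1 u) (\<lambda>\<rho> u. \<bar>u\<bar> powr zeta_b \<rho> * exp (- 2 * \<bar>u\<bar>)) \<and>
        Theta_uniformly K at_bot (\<lambda>\<rho> u. b_rho \<rho> 1 u) (\<lambda>\<rho> u. \<bar>u\<bar> powr zeta_a \<rho> * exp (- 2 * \<bar>u\<bar>)))"
proof (intro conjI allI impI)
  fix \<rho> :: real assume "\<rho> > 0"
  \<comment> \<open>The statement for a single \<rho> is the uniform one on a compact
    singleton.\<close>
  then have K: "compact {\<rho>}" "{\<rho>} \<subseteq> {0<..}" by auto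
  note top = Theta_uniformly_rho[OF K, THEN Theta_uniformly_imp_bigtheta]
  note bot = Theta_uniformly_rho_at_bot[OF K, THEN Theta_uniformly_imp_bigtheta]
  show "f_rho \<rho> 1 \<in> \<Theta>[at_top](\<lambda>u. u powr zeta_f \<rho> * exp (- 2 * u))" by (rule top(1))
  show "g_rho \<rho> 1 \<in> \<Theta>[at_top](\<lambda>u. u powr zeta_g \<rho> * exp (- 2 * u))" by (rule top(2))
  show "a_rho \<rho> 1 \<in> \<Theta>[at_top](\<lambda>u. u powr zeta_a \<rho> * exp (- 2 * u))" by (rule top(3))
  show "b_rho \<rho> 1 \<in> \<Theta>[at_top](\<lambda>u. u powr zeta_b \<rho> * exp (- 2 * u))" by (rule top(4))
  show "f_rho \<rho> 1 \<in> \<Theta>[at_bot](\<lambda>u. \<bar>u\<bar> powr zeta_g \<rho> * exp (- 2 * \<bar>u\<bar>))" by (rule bot(1))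
  show "g_rho \<rho> 1 \<in> \<Theta>[at_bot](\<lambda>u. \<bar>u\<bar> powr zeta_f \<rho> * exp (- 2 * \<bar>u\<bar>))" by (rule bot(2))
  show "a_rho \<rho> 1 \<in> \<Theta>[at_bot](\<lambda>u. \<bar>u\<bar> powr zeta_b \<rho> * exp (- 2 * \<bar>u\<bar>))" by (rule bot(3))
  show "b_rho \<rho> 1 \<in> \<Theta>[at_bot](\<lambda>u. \<bar>u\<bar> powr zeta_a \<rho> * exp (- 2 * \<bar>u\<bar>))" by (rule bot(4))
qed (fact Theta_uniformly_rho Theta_uniformly_rho_at_bot)+

end
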